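(* Let $n\ge 2$ be an integer, $\Delta\ge0$ a real number and $\rho'\ge0$. Consider $n$ homogeneous nodes with common throughput demand $\rho'$ in the power capture model with parameter $\Delta$ and i.i.d. Rayleigh fading, where perfect CSI is available to all nodes. Suppose that the demand vector $(\rho',\dots,\rho')$ is achievable by a symmetric Nash equilibrium point, i.e. one of the form $(p,\dots,p)$ with $p\in[0,1]$. (i) If $0\le\Delta\le\frac1{n-1}$, then there is exactly one symmetric Nash equilibrium point for $(\rho',\dots,\rho')$. (ii) If $\Delta>\frac1{n-1}$, then there are at most two symmetric Nash equilibrium points for $(\rho',\dots,\rho')$.
   Context: Setting (one time slot): nodes $1,\dots,n$ may transmit to a base station, each with the same power. Let $X_i=|h_i|^2$ be the channel power gain of node $i$; $X_1,\dots,X_n$ are i.i.d. exponential random variables with density $e^{-x}$, $x\ge 0$ (Rayleigh fading). Perfect CSI: each node knows its own channel gain, and node $i$ with average transmission probability $p_i\in[0,1]$ uses the threshold strategy $B_i=1$ (transmit) iff $X_i>T_i$, and $B_i=0$ otherwise, where $T_i\in[0,\infty]$ satisfies $e^{-T_i}=p_i$ ($T_i=\infty$ if $p_i=0$). Power capture model with parameter $\Delta\ge0$: node $i$'s packet is successfully received iff $B_iX_i>\max_{j\ne i}\{(1+\Delta)B_jX_j\}$. The average throughput $r_i(p_i,\mathbf p_{-i})$ of node $i$ is the probability that its packet is successfully received when node $i$ has average transmission probability $p_i$ and the others have $\mathbf p_{-i}=(p_j)_{j\ne i}$; thus $$r_i(p_i,\mathbf p_{-i})=\int_{T_i}^\infty\prod_{j\ne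 i}\max\{1-p_j,\;1-e^{-x/(1+\Delta)}\}\,e^{-x}\,dx.$$ A vector $(p_1,\dots,p_n)\in[0,1]^n$ is a Nash equilibrium point for throughput demands $(\rho_1,\dots,\rho_n)$ if for every $i$, $p_i\in\arg\min_{0\le\tilde p_i\le1}\{\tilde p_i: r_i(\tilde p_i,\mathbf p_{-i})\ge\rho_i\}$; since $r_i$ is increasing in $p_i$, this is equivalent to $r_i(p_i,\mathbf p_{-i})=\rho_i$ for all $i$. A demand vector is achievable if a Nash equilibrium point for it exists. *)

theory Defs
  imports "HOL-Probability.Probability"
begin

text \<open>
  Nodes are indexed by \<open>{1..n}\<close>. A vector of average transmission probabilities is an
  extensional function on \<open>{1..n}\<close>, so that two vectors are equal iff they agree on all nodes.
\<close>

definition iid_rayleigh_gains :: "'w measure \<Rightarrow> (nat \<Rightarrow> 'w \<Rightarrow> real) \<Rightarrow> nat \<Rightarrow> bool" where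
  "iid_rayleigh_gains M X n \<longleftrightarrow>
     prob_space M \<and>
     prob_space.indep_vars M (\<lambda>_. borel) X {1..n} \<and>
     (\<forall>i\<in>{1..n}. distributed M lborel (X i) (exponential_density 1))"

definition threshold :: "real \<Rightarrow> ereal" where
  "threshold p = (if p = 0 then \<infinity> else ereal (- ln p))"

lemma threshold_eq_iff:
  assumes "0 < p"
  shows "threshold p = ereal t \<longleftrightarrow> exp (- t) = p"
  using assms by (auto simp: threshold_def ln_div)

definition transmits :: "real \<Rightarrow> real \<Rightarrow> real" where
  "transmits p x = (if threshold p < ereal x then 1 else 0)"

text \<open>
  The channel gains of a realisation are \<open>x\<close>. The maximum ranges over a nonempty set
  only for \<open>n \<ge> 2\<close>.
\<close>

definition received :: "nat \<Rightarrow> real \<Rightarrow> (nat \<Rightarrow> real) \<Rightarrow> nat \<Rightarrow> (nat \<Rightarrow> real) \<Rightarrow> bool" where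
  "received n \<Delta> p i x \<longleftrightarrow>
     transmits (p i) (x i) * x i >
     Max ((\<lambda>j. (1 + \<Delta>) * transmits (p j) (x j) * x j) ` ({1..n} - {i}))"

definition throughput ::
  "'w measure \<Rightarrow> (nat \<Rightarrow> 'w \<Rightarrow> real) \<Rightarrow> nat \<Rightarrow> real \<Rightarrow> nat \<Rightarrow> (nat \<Rightarrow> real) \<Rightarrow> real" where
  "throughput M X n \<Delta> i p = measure M {\<omega> \<in> space M. received n \<Delta> p i (\<lambda>j. X j \<omega>)}"

definition nash_equilibrium ::
  "'w measure \<Rightarrow> (nat \<Rightarrow> 'w \<Rightarrow> real) \<Rightarrow> nat \<Rightarrow> real \<Rightarrow> (nat \<Rightarrow> real) \<Rightarrow> (nat \<Rightarrow> real) \<Rightarrow> bool" where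
  "nash_equilibrium M X n \<Delta> \<rho> p \<longleftrightarrow>
     p \<in> {1..n} \<rightarrow>\<^sub>E {0..1} \<and>
     (\<forall>i\<in>{1..n}.
        is_arg_min (\<lambda>q. q) (\<lambda>q. q \<in> {0..1} \<and> throughput M X n \<Delta> i (p(i := q)) \<ge> \<rho> i) (p i))"

definition symmetric_nash_equilibria ::
  "'w measure \<Rightarrow> (nat \<Rightarrow> 'w \<Rightarrow> real) \<Rightarrow> nat \<Rightarrow> real \<Rightarrow> (nat \<Rightarrow> real) \<Rightarrow> (nat \<Rightarrow> real) set" where
  "symmetric_nash_equilibria M X n \<Delta> \<rho> =
     {p. nash_equilibrium M X n \<Delta> \<rho> p \<and> (\<exists>c\<in>{0..1}. \<forall>i\<in>{1..n}. p i = c)}"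

end

theory Submission
  imports Defs
begin

text \<open>
  Put \<open>m = n - 1\<close> and \<open>a = 1 + \<Delta>\<close>. If all nodes use \<open>p\<close>, the throughput \<open>f p\<close> satisfies
  \<open>f' p = (1 - p) ^ (m - 1) * g p\<close> with \<open>g p = 1 - (m + 1) * p + m * p powr a\<close>. The function \<open>g\<close>
  is convex with \<open>g 0 = 1\<close>, \<open>g 1 = 0\<close> and \<open>g' 1 = m * \<Delta> - 1\<close>. For \<open>m * \<Delta> \<le> 1\<close> it is positive on
  \<open>(0, 1)\<close> and \<open>f\<close> is injective; otherwise it changes sign exactly once and \<open>f\<close> takes each value at
  most twice. At an equilibrium \<open>f p\<close> equals the demand: lowering \<open>p\<^sub>i\<close> by \<open>\<epsilon>\<close> costs node \<open>i\<close> at most \<open>\<epsilon>\<close>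
  of throughput, so a node with a surplus could transmit less.
\<close>

section \<open>Reception as conditions on single gains\<close>

text \<open>Thresholds are nonnegative, so a transmitting node has a positive gain and a silent one
  contributes 0. Hence a silent competitor never beats a transmitting node \<open>i\<close>, and a
  silent node \<open>i\<close> cannot strictly exceed a maximum of nonnegative terms.\<close>

lemma received_iff:
  assumes "n \<ge> 2" "\<Delta> \<ge> 0" "i \<in> {1..n}" and p: "\<And>j. j \<in> {1..n} \<Longrightarrow> p j \<in> {0..1}"
  shows "received n \<Delta> p i x \<longleftrightarrow>
    threshold (p i) < ereal (x i) \<and>
    (\<forall>j\<in>{1..n} - {i}. ereal (x j) \<le> threshold (p j) \<or> (1 + \<Delta>) * x j < x i)"
proof -
  \<comment> \<open>A second node exists because n \<ge> 2. With a nonempty index set, the condition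
    on \<open>Max\<close> splits into one strict inequality per competitor.\<close>
  have "(if i = 1 then 2 else 1) \<in> {1..n} - {i}"
    using assms by auto
  then have ne: "{1..n} - {i} \<noteq> {}"
    by blast
  have pos: "0 < x j" if "threshold (p j) < ereal (x j)" "j \<in> {1..n}" for j
  proof -
    have "0 \<le> threshold (p j)"
      using p[OF that(2)] by (auto simp: threshold_def zero_ereal_def)
    with that(1) show ?thesis
      by (metis ereal_less(2) order_le_less_trans)
  qed
  have "received n \<Delta> p i x \<longleftrightarrow>
      (\<forall>j\<in>{1..n} - {i}. (1 + \<Delta>) * transmits (p j) (x j) * x j < transmits (p i) (x i) * x i)"
    unfolding received_def using ne by simp
  also have "\<dots> \<longleftrightarrow> threshold (p i) < ereal (x i) \<and>
    (\<forall>j\<in>{1..n} - {i}. ereal (x j) \<le> threshold (p j) \<or> (1 + \<Delta>) * x j < x i)"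
  proof (cases "threshold (p i) < ereal (x i)")
    case True
    then show ?thesis
      using pos[OF True \<open>i \<in> {1..n}\<close>]
      by (simp add: transmits_def) (meson linorder_not_le)
  next
    case False
    have "0 \<le> (1 + \<Delta>) * transmits (p j) (x j) * x j" if "j \<in> {1..n}" for j
      using pos[OF _ that] \<open>\<Delta> \<ge> 0\<close> by (auto simp: transmits_def less_imp_le)
    then have "\<not> (1 + \<Delta>) * transmits (p j) (x j) * x j < 0" if "j \<in> {1..n}" for j
      using that by (simp only: not_less)
    moreover have "transmits (p i) (x i) * x i = 0"
      using False by (simp add: transmits_def)
    ultimately show ?thesis
      using False ne by auto
  qed
  finally show ?thesis .
qed

section \<open>Exponential gains and the probability of reception\<close>

lemma emeasure_exponential_atMost:
  assumes "0 \<le> t"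
  shows "emeasure (density lborel (exponential_density 1)) {..t} = ennreal (1 - exp (- t))"
  using emeasure_erlang_density[of 1 0 t] assms by (simp add: erlang_CDF_0)

lemma emeasure_exponential_lessThan:
  assumes "0 \<le> t"
  shows "emeasure (density lborel (exponential_density 1)) {..<t} = ennreal (1 - exp (- t))"
proof -
  let ?D = "density lborel (exponential_density 1)"
  have "AE x in lborel. indicator {..t} x = (indicator {..<t} x :: ennreal)"
    using AE_lborel_singleton[of t] by eventually_elim (auto split: split_indicator)
  then have "emeasure ?D {..t} = emeasure ?D {..<t}"
    by (subst (1 2) emeasure_density) (auto intro!: nn_integral_cong_AE elim: eventually_mono)
  then show ?thesis
    using emeasure_exponential_atMost[OF assms] by simp
qed

text \<open>Staying silent and being captured by a packet of gain \<open>y\<close> are both lower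
  half-lines for the competitor's gain. Their union is the longer one, which produces the maximum of
  two distribution functions.\<close>

lemma emeasure_exponential_silent_or_captured:
  assumes "0 \<le> t" "0 < a" "0 \<le> y"
  shows "emeasure (density lborel (exponential_density 1)) {z. z \<le> t \<or> a * z < y} =
    ennreal (max (1 - exp (- t)) (1 - exp (- (y / a))))"
proof -
  have less_iff: "a * z < y \<longleftrightarrow> z < y / a" for z
    using \<open>0 < a\<close> by (simp add: pos_less_divide_eq mult.commute)
  show ?thesis
  proof (cases "t < y / a")
    case True
    then have "{z. z \<le> t \<or> a * z < y} = {..<y / a}"
      unfolding less_iff by auto
    then show ?thesis
      using True assms by (simp add: emeasure_exponential_lessThan max_def)
  next
    case False
    then have "{z. z \<le> t \<or> a * z < y} = {..t}"
      unfolding less_iff by auto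
    then show ?thesis
      using False assms by (simp add: emeasure_exponential_atMost max_def)
  qed
qed

text \<open>Condition on the gain \<open>y\<close> of node \<open>i\<close>. By independence the
  other n - 1 nodes are harmless independently of each other, so their common probability appears to
  the power n - 1.\<close>

lemma emeasure_received_symmetric:
  assumes "n \<ge> 2" "\<Delta> \<ge> 0" and iid: "iid_rayleigh_gains M X n" and i: "i \<in> {1..n}"
    and c: "0 < c" "c \<le> 1" and p: "\<And>j. j \<in> {1..n} \<Longrightarrow> p j = c"
  shows "emeasure M {\<omega> \<in> space M. received n \<Delta> p i (\<lambda>j. X j \<omega>)} =
    (\<integral>\<^sup>+y. ennreal (max (1 - c) (1 - exp (- (y / (1 + \<Delta>)))) ^ (n - 1) * exp (- y)) *
      indicator {- ln c..} y \<partial>lborel)"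
proof -
  define D where "D = density lborel (exponential_density 1)"
  define J where "J = {1..n} - {i}"
  define T where "T = - ln c"
  define a where "a = 1 + \<Delta>"
  define S where "S y = {z. z \<le> T \<or> a * z < y}" for y
  \<comment> \<open>The reception event, moved from the abstract sample space to the space of gain
    vectors, where independence becomes a product measure.\<close>
  define A where "A = {x \<in> space (\<Pi>\<^sub>M j\<in>insert i J. D). T < x i \<and> (\<forall>j\<in>J. x j \<in> S (x i))}"
  have IJ: "{1..n} = insert i J" "finite J" "i \<notin> J" "card J = n - 1"
    using i by (auto simp: J_def)
  have "0 \<le> T" "0 < a" using c \<open>\<Delta> \<ge> 0\<close> by (auto simp: T_def a_def)
  have setsD [measurable_cong]: "sets D = sets borel" and spaceD [simp]: "space D = UNIV"
    by (simp_all add: D_def)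
  interpret M: prob_space M
    using iid by (simp add: iid_rayleigh_gains_def)
  interpret D: prob_space D
    unfolding D_def by (rule prob_space_exponential_density) simp
  interpret product_sigma_finite "\<lambda>_::nat. D" ..
  have D_X: "distributed M lborel (X j) (exponential_density 1)" if "j \<in> {1..n}" for j
    using iid that by (auto simp: iid_rayleigh_gains_def)
  have rv [measurable]: "X j \<in> borel_measurable M" if "j \<in> {1..n}" for j
    using distributed_measurable[OF D_X[OF that]] by simp
  have distr: "distr M borel (X j) = D" if "j \<in> {1..n}" for j
    unfolding D_def using distributed_distr_eq_density[OF D_X[OF that]]
    by (metis distr_cong sets_lborel)
  have PiM_D: "(\<Pi>\<^sub>M j\<in>{1..n}. distr M borel (X j)) = (\<Pi>\<^sub>M j\<in>insert i J. D)"
    unfolding IJ(1)[symmetric] by (rule PiM_cong) (use distr in auto)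
  have "M.indep_vars (\<lambda>_. borel) X {1..n}"
    using iid by (simp add: iid_rayleigh_gains_def)
  then have PiM: "distr M (\<Pi>\<^sub>M j\<in>{1..n}. borel) (\<lambda>\<omega>. \<lambda>j\<in>{1..n}. X j \<omega>) = (\<Pi>\<^sub>M j\<in>insert i J. D)"
    using M.indep_vars_iff_distr_eq_PiM'[of "{1..n}" X "\<lambda>_. borel"] rv i PiM_D by simp
  have [measurable]: "A \<in> sets (\<Pi>\<^sub>M j\<in>insert i J. D)"
    unfolding A_def S_def mem_Collect_eq using \<open>finite J\<close> by measurable
  have sets_eq: "sets (\<Pi>\<^sub>M j\<in>{1..n}. borel) = sets (\<Pi>\<^sub>M j\<in>insert i J. D)"
    using IJ(1) by (auto intro!: sets_PiM_cong simp: setsD)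
  have "emeasure M {\<omega> \<in> space M. received n \<Delta> p i (\<lambda>j. X j \<omega>)} =
      emeasure M ((\<lambda>\<omega>. \<lambda>j\<in>{1..n}. X j \<omega>) -` A \<inter> space M)"
    using received_iff[OF assms(1,2) i, of p] p c i
    by (intro arg_cong[where f = "emeasure M"])
      (auto simp: A_def S_def J_def T_def a_def threshold_def space_PiM insert_absorb)
  also have "\<dots> = emeasure (\<Pi>\<^sub>M j\<in>insert i J. D) A"
    unfolding PiM[symmetric]
    by (rule emeasure_distr[symmetric])
      (use \<open>A \<in> _\<close> in \<open>auto simp only: sets_eq intro!: measurable_restrict rv\<close>)
  \<comment> \<open>Tonelli: the coordinate \<open>i\<close> is integrated last.\<close>
  also have "\<dots> = (\<integral>\<^sup>+y. (\<integral>\<^sup>+x. indicator A (x(i := y)) \<partial>(\<Pi>\<^sub>M j\<in>J. D)) \<partial>D)"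
    using \<open>finite J\<close> \<open>i \<notin> J\<close>
    by (subst product_nn_integral_insert_rev[symmetric]) auto
  also have "\<dots> = (\<integral>\<^sup>+y. indicator {T<..} y *
      ennreal (max (1 - c) (1 - exp (- (y / a))) ^ (n - 1)) \<partial>D)"
  proof (intro nn_integral_cong)
    fix y
    \<comment> \<open>For fixed \<open>y\<close> the section of \<open>A\<close> is empty or a box
      whose sides are all \<open>S y\<close>.\<close>
    have "(\<integral>\<^sup>+x. indicator A (x(i := y)) \<partial>(\<Pi>\<^sub>M j\<in>J. D)) =
        (\<integral>\<^sup>+x. indicator {T<..} y * indicator (\<Pi>\<^sub>E j\<in>J. S y) x \<partial>(\<Pi>\<^sub>M j\<in>J. D))"
      using \<open>i \<notin> J\<close>
      by (intro nn_integral_cong)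
        (auto simp: A_def space_PiM PiE_iff extensional_def split: split_indicator)
    also have "\<dots> = indicator {T<..} y * emeasure (\<Pi>\<^sub>M j\<in>J. D) (\<Pi>\<^sub>E j\<in>J. S y)"
      using \<open>finite J\<close> by (intro nn_integral_cmult_indicator sets_PiM_I_finite) (auto simp: setsD S_def)
    also have "emeasure (\<Pi>\<^sub>M j\<in>J. D) (\<Pi>\<^sub>E j\<in>J. S y) = emeasure D (S y) ^ (n - 1)"
      using IJ by (subst emeasure_PiM) (auto simp: setsD S_def)
    also have "indicator {T<..} y * emeasure D (S y) ^ (n - 1) =
        indicator {T<..} y * ennreal (max (1 - c) (1 - exp (- (y / a))) ^ (n - 1))"
    proof (cases "T < y")
      case True
      then have "0 \<le> y"
        using \<open>0 \<le> T\<close> by simp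
      then have "emeasure D (S y) = ennreal (max (1 - c) (1 - exp (- (y / a))))"
        using emeasure_exponential_silent_or_captured[of T a y] \<open>0 \<le> T\<close> \<open>0 < a\<close> c
        by (simp add: D_def S_def T_def)
      then show ?thesis
        using c by (simp add: ennreal_power)
    qed simp
    finally show "(\<integral>\<^sup>+x. indicator A (x(i := y)) \<partial>(\<Pi>\<^sub>M j\<in>J. D)) =
        indicator {T<..} y * ennreal (max (1 - c) (1 - exp (- (y / a))) ^ (n - 1))" .
  qed
  also have "\<dots> = (\<integral>\<^sup>+y. ennreal (exponential_density 1 y) * (indicator {T<..} y *
      ennreal (max (1 - c) (1 - exp (- (y / a))) ^ (n - 1))) \<partial>lborel)"
    unfolding D_def by (rule nn_integral_density) auto
  \<comment> \<open>Including the endpoint \<open>T\<close> changes only a null set and gives the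
    closed half-line used in the later integration.\<close>
  also have "\<dots> = (\<integral>\<^sup>+y. ennreal (max (1 - c) (1 - exp (- (y / a))) ^ (n - 1) * exp (- y)) *
      indicator {T..} y \<partial>lborel)"
    using \<open>0 \<le> T\<close> c
    by (intro nn_integral_cong_AE AE_I'[of "{T}"])
      (auto simp: exponential_density_def ennreal_mult mult.commute split: split_indicator)
  finally show ?thesis
    by (simp add: T_def a_def)
qed

section \<open>Closed form of the common throughput\<close>

text \<open>The integral of \<open>(1 - exp (- y / a)) ^ m * exp (- y)\<close> over \<open>y \<ge> t\<close>, by binomial expansion.\<close>

definition captured_tail :: "nat \<Rightarrow> real \<Rightarrow> real \<Rightarrow> real" where
  "captured_tail m a t =
     (\<Sum>k\<le>m. of_nat (m choose k) * (- 1) ^ k * exp (- ((1 + k / a) * t)) / (1 + k / a))"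

text \<open>Differentiating each summand cancels its denominator \<open>1 + k / a\<close>; the
  binomial theorem then reassembles the power.\<close>

lemma captured_tail_deriv:
  assumes "0 < a"
  shows "(captured_tail m a has_real_derivative - ((1 - exp (- (t / a))) ^ m * exp (- t))) (at t)"
proof -
  have nz: "1 + real k / a \<noteq> 0" for k
    using assms by (smt (verit) divide_nonneg_pos of_nat_0_le_iff)
  have "((\<lambda>t. C * exp (- (b * t)) / b) has_real_derivative C * - exp (- (b * t))) (at t)"
    if "b \<noteq> 0" for b C :: real
    using that by (auto intro!: derivative_eq_intros)
  with nz have "(captured_tail m a has_real_derivative
      (\<Sum>k\<le>m. of_nat (m choose k) * (- 1) ^ k * - exp (- ((1 + k / a) * t)))) (at t)"
    unfolding captured_tail_def[abs_def] by (intro DERIV_sum) blast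
  moreover have "exp (- ((1 + real k / a) * t)) = exp (- (t / a)) ^ k * exp (- t)" for k
    by (simp add: exp_of_nat_mult[symmetric] exp_add[symmetric] algebra_simps)
  moreover have "(1 - exp (- (t / a))) ^ m = (\<Sum>k\<le>m. of_nat (m choose k) * (- exp (- (t / a))) ^ k)"
    using binomial_ring[of "- exp (- (t / a))" 1 m] by simp
  moreover have "(- exp (- (t / a))) ^ k = (- 1) ^ k * exp (- (t / a)) ^ k" for k
    by (metis mult_minus1 power_mult_distrib)
  ultimately show ?thesis
    by (simp add: sum_distrib_right sum_negf[symmetric] mult.assoc)
qed

lemma captured_tail_tendsto_0:
  assumes "0 < a"
  shows "(captured_tail m a \<longlongrightarrow> 0) at_top"
proof -
  have "((\<lambda>t. of_nat (m choose k) * (- 1) ^ k * exp (- ((1 + k / a) * t)) / (1 + k / a))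
      \<longlongrightarrow> 0) at_top" for k :: nat
  proof -
    have "0 < 1 + real k / a"
      using assms by (smt (verit) divide_nonneg_pos of_nat_0_le_iff)
    then have "filterlim (\<lambda>t. (1 + real k / a) * t) at_top at_top"
      by (intro filterlim_tendsto_pos_mult_at_top[OF tendsto_const]) (auto simp: filterlim_ident)
    then have "((\<lambda>t. exp (- ((1 + real k / a) * t))) \<longlongrightarrow> 0) at_top"
      by (intro filterlim_compose[OF exp_at_bot] filterlim_compose[OF filterlim_uminus_at_bot_at_top])
    then show ?thesis
      by (intro tendsto_divide_zero tendsto_mult_right_zero)
  qed
  then show ?thesis
    unfolding captured_tail_def[abs_def] by (intro tendsto_null_sum) auto
qed

text \<open>The function is nonincreasing on the nonnegative half-line and tends to 0 at
  infinity.\<close>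

lemma captured_tail_nonneg:
  assumes "0 < a" "0 \<le> t"
  shows "0 \<le> captured_tail m a t"
proof -
  have "captured_tail m a s \<le> captured_tail m a t" if "t \<le> s" for s
  proof (rule DERIV_nonpos_imp_nonincreasing[OF that])
    fix x assume "t \<le> x"
    then have "0 \<le> 1 - exp (- (x / a))"
      using assms by simp
    then show "\<exists>y. (captured_tail m a has_real_derivative y) (at x) \<and> y \<le> 0"
      using captured_tail_deriv[OF \<open>0 < a\<close>] by (metis exp_ge_zero mult_nonneg_nonneg neg_le_0_iff_le zero_le_power)
  qed
  then have "\<forall>\<^sub>F s in at_top. captured_tail m a s \<le> captured_tail m a t"
    by (rule eventually_at_top_linorderI)
  with captured_tail_tendsto_0[OF \<open>0 < a\<close>] show ?thesis
    by (rule tendsto_upperbound) simp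
qed

text \<open>With \<open>m = n - 1\<close> and \<open>a = 1 + \<Delta>\<close>, this is the paper's \<open>r\<^sub>i(p, (p, \<dots>, p))\<close>: the packet of
  a node whose gain lies between \<open>- ln p\<close> and \<open>- a * ln p\<close> survives iff all other nodes are silent.\<close>

definition symmetric_rate :: "nat \<Rightarrow> real \<Rightarrow> real \<Rightarrow> real" where
  "symmetric_rate m a p = (1 - p) ^ m * (p - p powr a) + captured_tail m a (- (a * ln p))"

text \<open>The maximum in the integrand switches at y = \<open>a * T\<close>: below, silence of a
  competitor is the likelier alternative; above, capture is. The first piece has an elementary
  antiderivative, the second is \<open>captured_tail\<close>.\<close>

lemma throughput_symmetric:
  assumes "n \<ge> 2" "\<Delta> \<ge> 0" "iid_rayleigh_gains M X n" "i \<in> {1..n}"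
    and c: "0 < c" "c \<le> 1" and p: "\<And>j. j \<in> {1..n} \<Longrightarrow> p j = c"
  shows "throughput M X n \<Delta> i p = symmetric_rate (n - 1) (1 + \<Delta>) c"
proof -
  define a m where "a = 1 + \<Delta>" and "m = n - 1"
  define T where "T = - ln c"
  have "1 \<le> a" "0 \<le> T" "c = exp (- T)"
    using \<open>\<Delta> \<ge> 0\<close> c by (auto simp: a_def T_def)
  then have "T \<le> a * T"
    by (simp add: mult_le_cancel_right1)
  let ?h = "\<lambda>y. max (1 - c) (1 - exp (- (y / a))) ^ m * exp (- y)"
  have "c powr a = exp (- (a * T))"
    using c by (simp add: powr_def T_def)
  have captured_nonneg: "0 \<le> (1 - exp (- (y / a))) ^ m * exp (- y)" if "a * T \<le> y" for y
    using that \<open>1 \<le> a\<close> \<open>0 \<le> T\<close> by (smt (verit) divide_nonneg_pos exp_ge_zero mult_nonneg_nonneg one_le_exp_iff zero_le_power exp_le_one_iff)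
  have "(\<integral>\<^sup>+y. ennreal (?h y) * indicator {T..} y \<partial>lborel) =
    (\<integral>\<^sup>+y. ennreal ((1 - c) ^ m * exp (- y)) * indicator {T..a * T} y +
      ennreal ((1 - exp (- (y / a))) ^ m * exp (- y)) * indicator {a * T..} y \<partial>lborel)"
  \<comment> \<open>The two closed ranges overlap in \<open>a * T\<close>, so the identity holds
    only almost everywhere.\<close>
  proof (intro nn_integral_cong_AE AE_I'[of "{a * T}"])
    have "max (1 - c) (1 - exp (- (y / a))) = (if y < a * T then 1 - c else 1 - exp (- (y / a)))" for y
      using \<open>1 \<le> a\<close> by (auto simp: \<open>c = exp (- T)\<close> max_def field_simps)
    then show "{y \<in> space lborel. ennreal (?h y) * indicator {T..} y \<noteq>
       ennreal ((1 - c) ^ m * exp (- y)) * indicator {T..a * T} y +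
       ennreal ((1 - exp (- (y / a))) ^ m * exp (- y)) * indicator {a * T..} y} \<subseteq> {a * T}"
      using \<open>T \<le> a * T\<close> by (auto split: split_indicator)
  qed auto
  also have "\<dots> =
    (\<integral>\<^sup>+y. ennreal ((1 - c) ^ m * exp (- y)) * indicator {T..a * T} y \<partial>lborel) +
    (\<integral>\<^sup>+y. ennreal ((1 - exp (- (y / a))) ^ m * exp (- y)) * indicator {a * T..} y \<partial>lborel)"
    by (rule nn_integral_add) auto
  also have "(\<integral>\<^sup>+y. ennreal ((1 - c) ^ m * exp (- y)) * indicator {T..a * T} y \<partial>lborel) =
      ennreal (- ((1 - c) ^ m * exp (- (a * T))) - - ((1 - c) ^ m * exp (- T)))"
    using c \<open>T \<le> a * T\<close>
    by (intro nn_integral_FTC_Icc) (auto intro!: derivative_eq_intros)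
  also have "\<dots> = ennreal ((1 - c) ^ m * (c - c powr a))"
    by (simp add: \<open>c powr a = _\<close> \<open>c = exp (- T)\<close>[symmetric] algebra_simps)
  also have "(\<integral>\<^sup>+y. ennreal ((1 - exp (- (y / a))) ^ m * exp (- y)) * indicator {a * T..} y \<partial>lborel) =
      ennreal (0 - - captured_tail m a (a * T))"
  proof (rule nn_integral_FTC_atLeast)
    show "((\<lambda>t. - captured_tail m a t) \<longlongrightarrow> 0) at_top"
      using captured_tail_tendsto_0[of a m] \<open>1 \<le> a\<close> tendsto_minus by fastforce
    show "((\<lambda>t. - captured_tail m a t) has_real_derivative (1 - exp (- (y / a))) ^ m * exp (- y)) (at y)" for y
      using captured_tail_deriv[of a m y] \<open>1 \<le> a\<close> by (auto intro!: derivative_eq_intros)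
  qed (use captured_nonneg in auto)
  finally have *: "(\<integral>\<^sup>+y. ennreal (?h y) * indicator {T..} y \<partial>lborel) =
      ennreal ((1 - c) ^ m * (c - c powr a)) + ennreal (captured_tail m a (a * T))"
    by simp
  \<comment> \<open>Nonnegativity of both pieces allows their sum in \<open>ennreal\<close> to be
    read as a real sum.\<close>
  have "0 \<le> captured_tail m a (a * T)"
    using captured_tail_nonneg \<open>1 \<le> a\<close> \<open>0 \<le> T\<close> by simp
  moreover have "0 \<le> (1 - c) ^ m * (c - c powr a)"
    using c \<open>1 \<le> a\<close> powr_mono'[of 1 a c] by simp
  ultimately have "emeasure M {\<omega> \<in> space M. received n \<Delta> p i (\<lambda>j. X j \<omega>)} =
      ennreal ((1 - c) ^ m * (c - c powr a) + captured_tail m a (a * T))"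
    and "0 \<le> (1 - c) ^ m * (c - c powr a) + captured_tail m a (a * T)"
    using emeasure_received_symmetric[OF assms] * by (simp_all add: a_def m_def T_def)
  then show ?thesis
    by (simp add: throughput_def measure_def symmetric_rate_def a_def m_def T_def)
qed

lemma symmetric_rate_nonneg:
  assumes "1 \<le> a" "0 < c" "c \<le> 1"
  shows "0 \<le> symmetric_rate m a c"
proof -
  have "c powr a \<le> c"
    using assms powr_mono'[of 1 a c] by simp
  moreover have "0 \<le> captured_tail m a (- (a * ln c))"
    using assms by (intro captured_tail_nonneg) (auto simp: mult_nonneg_nonpos)
  ultimately show ?thesis
    using assms by (simp add: symmetric_rate_def)
qed

text \<open>Since \<open>exp (ln p) = p\<close>, the tail contributes
  \<open>a * (1 - p) ^ m * p powr (a - 1)\<close>. This cancels the matching term of the product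
  rule, and \<open>(1 - p) ^ (m - 1)\<close> factors out of the rest.\<close>

lemma symmetric_rate_deriv:
  assumes "0 < a" "0 < m" "0 < p"
  shows "(symmetric_rate m a has_real_derivative
    (1 - p) ^ (m - 1) * (1 - (real m + 1) * p + real m * p powr a)) (at p)"
proof -
  obtain k where m: "m = Suc k"
    using \<open>0 < m\<close> gr0_implies_Suc by blast
  have e: "exp (a * ln p) = p powr a" "p powr (a - 1) = p powr a / p"
    using \<open>0 < p\<close> powr_diff[of p a 1] by (auto simp: powr_def)
  have tail: "((\<lambda>p. captured_tail m a (- (a * ln p))) has_real_derivative
      - ((1 - exp (- (- (a * ln p) / a))) ^ m * exp (- (- (a * ln p)))) * - (a * (1 / p))) (at p)"
    using \<open>0 < p\<close>
    by (intro DERIV_chain2[OF captured_tail_deriv[OF \<open>0 < a\<close>]])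
      (auto intro!: derivative_eq_intros)
  have power: "((\<lambda>p. (1 - p) ^ m) has_real_derivative - (real m * (1 - p) ^ k)) (at p)"
    using m by (auto intro!: derivative_eq_intros simp del: power_Suc)
  have "(symmetric_rate m a has_real_derivative
      - (real m * (1 - p) ^ k) * (p - p powr a) + (1 - p) ^ m * (1 - a * p powr (a - 1)) +
      - ((1 - exp (- (- (a * ln p) / a))) ^ m * exp (- (- (a * ln p)))) * - (a * (1 / p))) (at p)"
    unfolding symmetric_rate_def[abs_def]
    by (rule DERIV_add[OF _ tail], rule derivative_eq_intros, rule power)
      (use \<open>0 < p\<close> in \<open>auto intro!: derivative_eq_intros\<close>)
  then show ?thesis
    by (rule DERIV_cong) (use \<open>0 < p\<close> \<open>0 < a\<close> in \<open>simp add: e m field_simps\<close>)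
qed

section \<open>Sign of the derivative\<close>

text \<open>This is g of the overview: not the full derivative of \<open>symmetric_rate\<close>, but
  the factor deciding its sign on (0, 1), where the power of \<open>1 - p\<close> is
  positive.\<close>

definition rate_slope :: "nat \<Rightarrow> real \<Rightarrow> real \<Rightarrow> real" where
  "rate_slope m a p = 1 - (real m + 1) * p + real m * p powr a"

lemma rate_slope_1 [simp]: "rate_slope m a 1 = 0"
  by (simp add: rate_slope_def)

lemma rate_slope_deriv:
  assumes "0 < p"
  shows "(rate_slope m a has_real_derivative real m * a * p powr (a - 1) - (real m + 1)) (at p)"
  unfolding rate_slope_def[abs_def] using assms by (auto intro!: derivative_eq_intros)

lemma continuous_on_rate_slope: "continuous_on {0<..} (rate_slope m a)"
  by (auto intro!: continuous_at_imp_continuous_on DERIV_isCont rate_slope_deriv)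

lemma continuous_on_symmetric_rate:
  assumes "0 < a" "0 < m"
  shows "continuous_on {0<..} (symmetric_rate m a)"
  using assms by (auto intro!: continuous_at_imp_continuous_on DERIV_isCont symmetric_rate_deriv)

text \<open>The assumption says m * a \<le> m + 1, so the function strictly decreases on (0, 1) to
  its value 0 at 1.\<close>

lemma rate_slope_pos:
  assumes "0 < m" "1 \<le> a" "real m * (a - 1) \<le> 1" "0 < p" "p < 1"
  shows "0 < rate_slope m a p"
proof -
  have "rate_slope m a 1 < rate_slope m a p"
  proof (rule DERIV_neg_imp_decreasing_open[OF \<open>p < 1\<close>])
    fix x assume x: "p < x" "x < 1"
    \<comment> \<open>For a = 1 the claim is m < m + 1; for a > 1 strictness comes from the power
      being below 1.\<close>
    have "real m * a * x powr (a - 1) < real m + 1"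
    proof (cases "a = 1")
      case False
      then have "x powr (a - 1) < 1"
        using x assms powr_less_mono2[of "a - 1" x 1] by simp
      then have "real m * a * x powr (a - 1) < real m * a * 1"
        using assms by (intro mult_strict_left_mono) auto
      then show ?thesis
        using assms(3) by (simp add: algebra_simps)
    qed (use x assms in simp)
    then show "\<exists>y. (rate_slope m a has_real_derivative y) (at x) \<and> y < 0"
      using rate_slope_deriv[of x m a] x assms by auto
  next
    show "continuous_on {p..1} (rate_slope m a)"
      using assms by (intro continuous_on_subset[OF continuous_on_rate_slope]) auto
  qed
  then show ?thesis by simp
qed

text \<open>The function falls until \<open>x0\<close> and then rises to 0 at 1, so it is negative
  on [\<open>x0\<close>, 1). Its only zero in (0, 1) therefore lies left of
  \<open>x0\<close>.\<close>

lemma rate_slope_single_sign_change: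
  assumes "0 < m" "1 < real m * (a - 1)"
  obtains q where "0 < q" "q < 1" "\<And>p. 0 < p \<Longrightarrow> p < q \<Longrightarrow> 0 < rate_slope m a p"
    "\<And>p. q < p \<Longrightarrow> p < 1 \<Longrightarrow> rate_slope m a p < 0"
proof -
  have "1 < a"
    using assms by (smt (verit) mult_nonneg_nonpos of_nat_0_le_iff)
  \<comment> \<open>The critical point, solving m * a * x powr (a - 1) = m + 1. It lies below 1
    because m * a > m + 1.\<close>
  define x0 where "x0 = ((real m + 1) / (real m * a)) powr (1 / (a - 1))"
  have "0 < x0" and x0_eq: "real m * a * x0 powr (a - 1) = real m + 1"
    using \<open>1 < a\<close> \<open>0 < m\<close> by (auto simp: x0_def powr_powr)
  have "x0 < 1"
  proof -
    have "(real m + 1) / (real m * a) < 1"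
      using assms \<open>1 < a\<close> by (simp add: field_simps)
    then show ?thesis
      unfolding x0_def using \<open>1 < a\<close> \<open>0 < m\<close>
        powr_less_mono2[of "1 / (a - 1)" "(real m + 1) / (real m * a)" 1] by simp
  qed
  have cont: "continuous_on {x..y} (rate_slope m a)" if "0 < x" for x y
    using that by (intro continuous_on_subset[OF continuous_on_rate_slope]) auto
  have dec: "rate_slope m a y < rate_slope m a x" if "0 < x" "x < y" "y \<le> x0" for x y
  proof (rule DERIV_neg_imp_decreasing_open[OF \<open>x < y\<close> _ cont[OF \<open>0 < x\<close>]])
    fix z assume z: "x < z" "z < y"
    then have "z powr (a - 1) < x0 powr (a - 1)"
      using that \<open>1 < a\<close> by (intro powr_less_mono2) auto
    then have "real m * a * z powr (a - 1) < real m + 1"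
      unfolding x0_eq[symmetric] using \<open>1 < a\<close> \<open>0 < m\<close> by simp
    then show "\<exists>d. (rate_slope m a has_real_derivative d) (at z) \<and> d < 0"
      using rate_slope_deriv[of z m a] z that by auto
  qed
  have inc: "rate_slope m a x < rate_slope m a y" if "x0 \<le> x" "x < y" for x y
  proof (rule DERIV_pos_imp_increasing_open[OF \<open>x < y\<close>])
    fix z assume z: "x < z" "z < y"
    then have "x0 powr (a - 1) < z powr (a - 1)"
      using that \<open>1 < a\<close> \<open>0 < x0\<close> by (intro powr_less_mono2) auto
    then have "real m + 1 < real m * a * z powr (a - 1)"
      unfolding x0_eq[symmetric] using \<open>1 < a\<close> \<open>0 < m\<close> by simp
    then show "\<exists>d. (rate_slope m a has_real_derivative d) (at z) \<and> d > 0"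
      using rate_slope_deriv[of z m a] z that \<open>0 < x0\<close> by auto
  qed (use cont that \<open>0 < x0\<close> in auto)
  have neg_x0: "rate_slope m a x0 < 0"
    using inc[of x0 1] \<open>x0 < 1\<close> by simp
  \<comment> \<open>At \<open>u\<close> the linear part 1 - (m + 1) * u vanishes, leaving the
    positive term m * u powr a. This gives a left end for the intermediate value theorem away from
    0.\<close>
  define u where "u = 1 / (real m + 1)"
  have "0 < u" "0 < rate_slope m a u"
    using \<open>0 < m\<close> by (auto simp: u_def rate_slope_def)
  \<comment> \<open>At any point up to \<open>u\<close> the linear part is nonnegative, which would
    contradict the negative value at \<open>x0\<close>.\<close>
  have "u < x0"
  proof (rule ccontr)
    assume "\<not> u < x0"
    then have "(real m + 1) * x0 \<le> 1"
      by (simp add: u_def field_simps)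
    then have "0 \<le> rate_slope m a x0"
      by (simp add: rate_slope_def)
    then show False using neg_x0 by simp
  qed
  obtain q where q: "u \<le> q" "q \<le> x0" "rate_slope m a q = 0"
    using IVT2'[of "rate_slope m a" x0 0 u] \<open>0 < rate_slope m a u\<close> neg_x0 \<open>u < x0\<close> cont[OF \<open>0 < u\<close>]
    by auto
  show thesis
  proof (rule that)
    show "0 < q" "q < 1"
      using q \<open>0 < u\<close> \<open>x0 < 1\<close> by auto
    show "0 < rate_slope m a p" if "0 < p" "p < q" for p
      using dec[of p q] that q by simp
    \<comment> \<open>Up to \<open>x0\<close> the function has decreased from its zero at
      \<open>q\<close>; beyond \<open>x0\<close> it is still increasing towards its zero at
      1.\<close>
    show "rate_slope m a p < 0" if "q < p" "p < 1" for p
      using dec[of q p] inc[of p 1] that q \<open>0 < q\<close> by (cases "p \<le> x0") auto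
  qed
qed

section \<open>Monotone branches of the throughput\<close>

lemma symmetric_rate_strict_increasing:
  assumes "0 < a" "0 < m" "0 < x" "x < y" "y \<le> 1"
    and pos: "\<And>p. x < p \<Longrightarrow> p < y \<Longrightarrow> 0 < rate_slope m a p"
  shows "symmetric_rate m a x < symmetric_rate m a y"
proof (rule DERIV_pos_imp_increasing_open[OF \<open>x < y\<close>])
  fix p assume p: "x < p" "p < y"
  then have "0 < (1 - p) ^ (m - 1) * rate_slope m a p"
    using pos assms by simp
  then show "\<exists>d. (symmetric_rate m a has_real_derivative d) (at p) \<and> 0 < d"
    using symmetric_rate_deriv[of a m p] p assms unfolding rate_slope_def by auto
next
  show "continuous_on {x..y} (symmetric_rate m a)"
    using assms by (intro continuous_on_subset[OF continuous_on_symmetric_rate]) auto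
qed

lemma symmetric_rate_strict_decreasing:
  assumes "0 < a" "0 < m" "0 < x" "x < y" "y \<le> 1"
    and neg: "\<And>p. x < p \<Longrightarrow> p < y \<Longrightarrow> rate_slope m a p < 0"
  shows "symmetric_rate m a y < symmetric_rate m a x"
proof (rule DERIV_neg_imp_decreasing_open[OF \<open>x < y\<close>])
  fix p assume p: "x < p" "p < y"
  then have "(1 - p) ^ (m - 1) * rate_slope m a p < 0"
    using neg assms by (simp add: mult_pos_neg)
  then show "\<exists>d. (symmetric_rate m a has_real_derivative d) (at p) \<and> d < 0"
    using symmetric_rate_deriv[of a m p] p assms unfolding rate_slope_def by auto
next
  show "continuous_on {x..y} (symmetric_rate m a)"
    using assms by (intro continuous_on_subset[OF continuous_on_symmetric_rate]) auto
qed

text \<open>At 0 the closed form would rest on the default value of \<open>ln 0\<close>, whereas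
  nodes that never transmit have throughput 0.\<close>

definition common_throughput :: "nat \<Rightarrow> real \<Rightarrow> real \<Rightarrow> real" where
  "common_throughput m a c = (if c = 0 then 0 else symmetric_rate m a c)"

lemma inj_on_common_throughput_below:
  assumes "1 \<le> a" "0 < m" "q \<le> 1"
    and pos: "\<And>p. 0 < p \<Longrightarrow> p < q \<Longrightarrow> 0 < rate_slope m a p"
  shows "inj_on (common_throughput m a) {0..q}"
proof (rule strict_mono_on_imp_inj_on, rule strict_mono_onI)
  fix x y assume xy: "x \<in> {0..q}" "y \<in> {0..q}" "x < y"
  show "common_throughput m a x < common_throughput m a y"
  proof (cases "x = 0")
    case True
    \<comment> \<open>Passing through \<open>y / 2\<close> makes the inequality with 0 strict
      without a limit of \<open>symmetric_rate\<close> at 0.\<close>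
    have "0 \<le> symmetric_rate m a (y / 2)"
      using xy True assms by (intro symmetric_rate_nonneg) auto
    also have "\<dots> < symmetric_rate m a y"
      using xy True assms by (intro symmetric_rate_strict_increasing) auto
    finally show ?thesis
      using True xy by (simp add: common_throughput_def)
  next
    case False
    then show ?thesis
      using xy assms symmetric_rate_strict_increasing[of a m x y]
      by (simp add: common_throughput_def)
  qed
qed

lemma inj_on_common_throughput_above:
  assumes "1 \<le> a" "0 < m" "0 < q"
    and neg: "\<And>p. q < p \<Longrightarrow> p < 1 \<Longrightarrow> rate_slope m a p < 0"
  shows "inj_on (common_throughput m a) {q..1}"
proof (rule linorder_inj_onI)
  fix x y assume "x < y" "x \<in> {q..1}" "y \<in> {q..1}"
  then show "common_throughput m a x \<noteq> common_throughput m a y"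
    using symmetric_rate_strict_decreasing[of a m x y] assms by (simp add: common_throughput_def)
qed auto

section \<open>Equilibria meet the demand exactly\<close>

lemma sets_received:
  assumes "n \<ge> 2" "\<Delta> \<ge> 0" "i \<in> {1..n}" "\<And>j. j \<in> {1..n} \<Longrightarrow> p j \<in> {0..1}"
    and [measurable]: "\<And>j. j \<in> {1..n} \<Longrightarrow> X j \<in> borel_measurable M"
  shows "{\<omega> \<in> space M. received n \<Delta> p i (\<lambda>j. X j \<omega>)} \<in> sets M"
proof -
  have "received n \<Delta> p i x \<longleftrightarrow> threshold (p i) < ereal (x i) \<and>
      (\<forall>j\<in>{1..n} - {i}. ereal (x j) \<le> threshold (p j) \<or> (1 + \<Delta>) * x j < x i)" for x
    using assms(1-4) by (rule received_iff)
  then show ?thesis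
    using \<open>i \<in> {1..n}\<close> by simp
qed

lemma prob_transmits:
  assumes "prob_space M" "distributed M lborel Y (exponential_density 1)" "c \<in> {0..1}"
  shows "measure M {\<omega> \<in> space M. threshold c < ereal (Y \<omega>)} = c"
proof (cases "c = 0")
  case False
  then show ?thesis
    using prob_space.exponential_distributedD_gt[OF assms(1,2), of "- ln c"] assms(3)
    by (simp add: threshold_def)
qed (simp add: threshold_def)

text \<open>Raising the threshold of node \<open>i\<close> can destroy a reception only if its gain
  lies between the old and the new threshold, an event of probability
  \<open>p i - q\<close>.\<close>

lemma throughput_loss_le:
  assumes "n \<ge> 2" "\<Delta> \<ge> 0" and iid: "iid_rayleigh_gains M X n" and i: "i \<in> {1..n}"
    and p: "\<And>j. j \<in> {1..n} \<Longrightarrow> p j \<in> {0..1}" and q: "0 \<le> q" "q \<le> p i"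
  shows "throughput M X n \<Delta> i p \<le> throughput M X n \<Delta> i (p(i := q)) + (p i - q)"
proof -
  interpret prob_space M
    using iid by (simp add: iid_rayleigh_gains_def)
  have D: "distributed M lborel (X j) (exponential_density 1)" if "j \<in> {1..n}" for j
    using iid that by (auto simp: iid_rayleigh_gains_def)
  have rv [measurable]: "X j \<in> borel_measurable M" if "j \<in> {1..n}" for j
    using distributed_measurable[OF D[OF that]] by simp
  have p': "(p(i := q)) j \<in> {0..1}" if "j \<in> {1..n}" for j
    using that p[OF that] p[OF i] q by auto
  let ?R = "\<lambda>p. {\<omega> \<in> space M. received n \<Delta> p i (\<lambda>j. X j \<omega>)}"
  let ?B = "\<lambda>c. {\<omega> \<in> space M. threshold c < ereal (X i \<omega>)}"
  have R: "?R p \<in> sets M" "?R (p(i := q)) \<in> sets M"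
    using sets_received[OF assms(1,2) i] p p' rv by blast+
  have B: "?B c \<in> sets M" for c
    using i by measurable
  have "threshold (p i) \<le> threshold q"
    using q by (auto simp: threshold_def)
  then have "?B q \<subseteq> ?B (p i)"
    by (auto intro: le_less_trans)
  have "?R p \<subseteq> ?R (p(i := q)) \<union> (?B (p i) - ?B q)"
    using received_iff[OF assms(1,2) i, of p] received_iff[OF assms(1,2) i, of "p(i := q)"] p p'
    by auto
  then have "measure M (?R p) \<le> measure M (?R (p(i := q)) \<union> (?B (p i) - ?B q))"
    using R B by (intro finite_measure_mono) auto
  also have "\<dots> \<le> measure M (?R (p(i := q))) + measure M (?B (p i) - ?B q)"
    using R B by (intro measure_Un_le) auto
  also have "measure M (?B (p i) - ?B q) = measure M (?B (p i)) - measure M (?B q)"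
    using B \<open>?B q \<subseteq> ?B (p i)\<close> by (intro finite_measure_Diff) auto
  also have "\<dots> = p i - q"
    using prob_transmits[OF prob_space_axioms D[OF i]] p[OF i] q by simp
  finally show ?thesis
    by (simp only: throughput_def)
qed

lemma throughput_common:
  assumes "n \<ge> 2" "\<Delta> \<ge> 0" "iid_rayleigh_gains M X n" "i \<in> {1..n}"
    and c: "c \<in> {0..1}" and p: "\<And>j. j \<in> {1..n} \<Longrightarrow> p j = c"
  shows "throughput M X n \<Delta> i p = common_throughput (n - 1) (1 + \<Delta>) c"
proof (cases "c = 0")
  case True
  then have "\<not> received n \<Delta> p i x" for x
    using received_iff[OF assms(1,2,4), of p x] p assms(4) by (simp add: threshold_def)
  then show ?thesis
    using True by (simp add: throughput_def common_throughput_def)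
next
  case False
  then show ?thesis
    using throughput_symmetric[OF assms(1-4)] c p by (simp add: common_throughput_def)
qed

text \<open>Feasibility excludes a deficit. A surplus would let node 1 lower its probability and
  still meet the demand, against minimality.\<close>

lemma symmetric_nash_equilibrium_demand:
  assumes "n \<ge> 2" "\<Delta> \<ge> 0" "\<rho>' \<ge> 0" "iid_rayleigh_gains M X n"
    and nash: "nash_equilibrium M X n \<Delta> (\<lambda>_. \<rho>') p"
    and c: "c \<in> {0..1}" and p: "\<And>j. j \<in> {1..n} \<Longrightarrow> p j = c"
  shows "common_throughput (n - 1) (1 + \<Delta>) c = \<rho>'"
proof (rule ccontr)
  let ?F = "common_throughput (n - 1) (1 + \<Delta>) c"
  assume neq: "?F \<noteq> \<rho>'"
  have one: "1 \<in> {1..n}" and "p 1 = c"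
    using \<open>n \<ge> 2\<close> p by auto
  have F: "throughput M X n \<Delta> 1 p = ?F"
    using assms one by (intro throughput_common) auto
  have min: "is_arg_min (\<lambda>q. q) (\<lambda>q. q \<in> {0..1} \<and> throughput M X n \<Delta> 1 (p(1 := q)) \<ge> \<rho>') c"
    using nash one \<open>p 1 = c\<close> unfolding nash_equilibrium_def by blast
  have "p(1 := c) = p"
    using \<open>p 1 = c\<close> by auto
  with min F neq have "\<rho>' < ?F"
    by (auto simp: is_arg_min_def)
  \<comment> \<open>A silent profile has throughput 0 and hence no surplus over a nonnegative
    demand.\<close>
  then have "c \<noteq> 0"
    using \<open>\<rho>' \<ge> 0\<close> by (auto simp: common_throughput_def)
  \<comment> \<open>Lower \<open>c\<close> by the surplus, cut off at 0: the throughput lost is at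
    most the decrease, so the demand stays met.\<close>
  define q where "q = max 0 (c - (?F - \<rho>'))"
  have q: "0 \<le> q" "q < c" "c - q \<le> ?F - \<rho>'"
    using \<open>\<rho>' < ?F\<close> \<open>c \<noteq> 0\<close> c by (auto simp: q_def)
  have "throughput M X n \<Delta> 1 p \<le> throughput M X n \<Delta> 1 (p(1 := q)) + (p 1 - q)"
    using assms one q by (intro throughput_loss_le) auto
  then have "\<rho>' \<le> throughput M X n \<Delta> 1 (p(1 := q))"
    using F q \<open>p 1 = c\<close> by simp
  then show False
    using min q c by (auto simp: is_arg_min_def)
qed

text \<open>One inclusion suffices: the theorem assumes that an equilibrium exists, so only upper
  bounds on their number remain.\<close>

lemma symmetric_nash_equilibria_subset:
  assumes "n \<ge> 2" "\<Delta> \<ge> 0" "\<rho>' \<ge> 0" "iid_rayleigh_gains M X n"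
  shows "symmetric_nash_equilibria M X n \<Delta> (\<lambda>_. \<rho>') \<subseteq>
    (\<lambda>c. \<lambda>i\<in>{1..n}. c) ` {c \<in> {0..1}. common_throughput (n - 1) (1 + \<Delta>) c = \<rho>'}"
proof
  fix p assume "p \<in> symmetric_nash_equilibria M X n \<Delta> (\<lambda>_. \<rho>')"
  then obtain c where nash: "nash_equilibrium M X n \<Delta> (\<lambda>_. \<rho>') p"
    and c: "c \<in> {0..1}" "\<And>i. i \<in> {1..n} \<Longrightarrow> p i = c"
    by (auto simp: symmetric_nash_equilibria_def)
  have "p \<in> extensional {1..n}"
    using nash by (auto simp: nash_equilibrium_def PiE_iff)
  then have "p = (\<lambda>i\<in>{1..n}. c)"
    using c(2) by (intro extensionalityI) auto
  moreover have "common_throughput (n - 1) (1 + \<Delta>) c = \<rho>'"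
    using symmetric_nash_equilibrium_demand[OF assms nash] c by blast
  ultimately show "p \<in> (\<lambda>c. \<lambda>i\<in>{1..n}. c) `
      {c \<in> {0..1}. common_throughput (n - 1) (1 + \<Delta>) c = \<rho>'}"
    using c(1) by blast
qed

section \<open>Counting the equilibria\<close>

text \<open>Inclusion in a singleton also covers an empty level set, for which the point is
  arbitrary. This happens when a branch misses the demand.\<close>

lemma inj_on_level_set_subset_singleton:
  assumes "inj_on f A"
  obtains x where "{a \<in> A. f a = y} \<subseteq> {x}"
proof (cases "\<exists>x\<in>A. f x = y")
  case True
  then obtain x where "x \<in> A" "f x = y"
    by blast
  then have "{a \<in> A. f a = y} \<subseteq> {x}"
    using assms by (auto dest: inj_onD)
  then show ?thesis
    by (rule that)
next
  case False
  then have "{a \<in> A. f a = y} \<subseteq> {undefined}"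
    by blast
  then show ?thesis
    by (rule that)
qed

theorem mainTheorem4:
  fixes M :: "'w measure" and X :: "nat \<Rightarrow> 'w \<Rightarrow> real"
    and n :: nat and \<Delta> \<rho>' :: real
  assumes "n \<ge> 2" and "\<Delta> \<ge> 0" and "\<rho>' \<ge> 0"
    and "iid_rayleigh_gains M X n"
    and "symmetric_nash_equilibria M X n \<Delta> (\<lambda>_. \<rho>') \<noteq> {}"
  shows "(\<Delta> \<le> 1 / (real n - 1) \<longrightarrow>
            (\<exists>!p. p \<in> symmetric_nash_equilibria M X n \<Delta> (\<lambda>_. \<rho>')))
       \<and> (\<Delta> > 1 / (real n - 1) \<longrightarrow>
            finite (symmetric_nash_equilibria M X n \<Delta> (\<lambda>_. \<rho>')) \<and>
            card (symmetric_nash_equilibria M X n \<Delta> (\<lambda>_. \<rho>')) \<le> 2)"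
proof (intro conjI impI)
  let ?S = "symmetric_nash_equilibria M X n \<Delta> (\<lambda>_. \<rho>')"
  let ?v = "\<lambda>c. \<lambda>i\<in>{1..n}. c"
  let ?F = "common_throughput (n - 1) (1 + \<Delta>)"
  have m: "0 < n - 1" "real (n - 1) = real n - 1" and a: "1 \<le> 1 + \<Delta>"
    using assms(1,2) by auto
  note sub = symmetric_nash_equilibria_subset[OF assms(1-4)]
  {
    assume "\<Delta> \<le> 1 / (real n - 1)"
    then have "real (n - 1) * (1 + \<Delta> - 1) \<le> 1"
      using m by (simp add: field_simps)
    then have "inj_on ?F {0..1}"
      using m(1) a by (intro inj_on_common_throughput_below rate_slope_pos) simp_all
    then obtain x where "{c \<in> {0..1}. ?F c = \<rho>'} \<subseteq> {x}"
      by (rule inj_on_level_set_subset_singleton)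
    with sub have "?S \<subseteq> {?v x}"
      by blast
    with assms(5) show "\<exists>!p. p \<in> ?S"
      by blast
  }
  assume "\<Delta> > 1 / (real n - 1)"
  then have "1 < real (n - 1) * (1 + \<Delta> - 1)"
    using m by (simp add: field_simps)
  then obtain q where q: "0 < q" "q < 1"
    "\<And>p. 0 < p \<Longrightarrow> p < q \<Longrightarrow> 0 < rate_slope (n - 1) (1 + \<Delta>) p"
    "\<And>p. q < p \<Longrightarrow> p < 1 \<Longrightarrow> rate_slope (n - 1) (1 + \<Delta>) p < 0"
    by (rule rate_slope_single_sign_change[OF m(1)]) (blast intro: that)
  have "inj_on ?F {0..q}"
    using inj_on_common_throughput_below[OF a m(1)] q by simp
  then obtain x where x: "{c \<in> {0..q}. ?F c = \<rho>'} \<subseteq> {x}"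
    by (rule inj_on_level_set_subset_singleton)
  have "inj_on ?F {q..1}"
    using inj_on_common_throughput_above[OF a m(1)] q by simp
  then obtain y where y: "{c \<in> {q..1}. ?F c = \<rho>'} \<subseteq> {y}"
    by (rule inj_on_level_set_subset_singleton)
  \<comment> \<open>Each of the two branches, meeting at \<open>q\<close>, contributes at most one
    solution.\<close>
  have "{c \<in> {0..1}. ?F c = \<rho>'} \<subseteq> {x, y}"
  proof
    fix c assume c: "c \<in> {c \<in> {0..1}. ?F c = \<rho>'}"
    then have "c \<in> {0..q} \<or> c \<in> {q..1}"
      by auto
    with c x y show "c \<in> {x, y}"
      by blast
  qed
  with sub have S: "?S \<subseteq> {?v x, ?v y}"
    by blast
  then show "finite ?S"
    by (rule finite_subset) simp
  have "card ?S \<le> card {?v x, ?v y}"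
    by (rule card_mono[OF _ S]) simp
  also have "\<dots> \<le> 2"
    using card_length[of "[?v x, ?v y]"] by simp
  finally show "card ?S \<le> 2" .
qed

end
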